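(* Let $m$ and $n$ be positive integers with $d = \gcd(m, n)$, $m = dm'$, and $n = dn'$. The size of every totally even subset of the edges of the $m \times n$ grid is of the form $4uvm'n'$ for some nonnegative integers $u$ and $v$ with $u + v = d$. Conversely, for all nonnegative integers $u$ and $v$ with $u + v = d$, there exists a totally even subset of the edges of the $m \times n$ grid of size $4uvm'n'$.
   Context: The $m \times n$ grid is the plane graph whose vertices are the integer points $(x, y)$ with $1 \le x \le m$ and $1 \le y \le n$ and whose edges are the unit segments between these points; its finite faces are the unit square cells. A subset $E$ of the edges of a planar graph $G$ is totally even when every vertex of $G$ is incident with an even number of edges of $E$ and every finite face of $G$ contains (on its boundary) an even number of edges of $E$. *)

theory Defs
  imports Complex_Main
begin

text \<open>A plane graph, given by its vertices, its edges (as two-element sets of vertices) and its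
  finite faces.  A finite face is represented by the set of the edges on its boundary; the
  unbounded face is not listed.\<close>

record 'a plane_graph =
  vertices :: "'a set"
  edges :: "'a set set"
  finite_faces :: "'a set set set"

definition totally_even :: "'a plane_graph \<Rightarrow> 'a set set \<Rightarrow> bool" where
  "totally_even G E \<longleftrightarrow>
     E \<subseteq> edges G \<and>
     (\<forall>v \<in> vertices G. even (card {e \<in> E. v \<in> e})) \<and>
     (\<forall>F \<in> finite_faces G. even (card (E \<inter> F)))"

definition cell_boundary :: "int \<Rightarrow> int \<Rightarrow> (int \<times> int) set set" where
  "cell_boundary x y =
     {{(x, y), (x + 1, y)}, {(x, y + 1), (x + 1, y + 1)},
      {(x, y), (x, y + 1)}, {(x + 1, y), (x + 1, y + 1)}}"

text \<open>\<open>m\<close> and \<open>n\<close> count vertices, not cells: there are \<open>(m - 1) * (n - 1)\<close> cells, each indexed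
  by its lower left corner.\<close>

definition grid :: "nat \<Rightarrow> nat \<Rightarrow> (int \<times> int) plane_graph" where
  "grid m n =
     \<lparr>vertices = {(x, y). 1 \<le> x \<and> x \<le> int m \<and> 1 \<le> y \<and> y \<le> int n},
      edges = {{(x, y), (x + 1, y)} | x y. 1 \<le> x \<and> x + 1 \<le> int m \<and> 1 \<le> y \<and> y \<le> int n} \<union>
              {{(x, y), (x, y + 1)} | x y. 1 \<le> x \<and> x \<le> int m \<and> 1 \<le> y \<and> y + 1 \<le> int n},
      finite_faces = {cell_boundary x y | x y.
                        1 \<le> x \<and> x + 1 \<le> int m \<and> 1 \<le> y \<and> y + 1 \<le> int n}\<rparr>"

end

theory Submission
  imports Defs
begin

text \<open>Doubling coordinates about the edge midpoints turns the evenness conditions at vertices and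
  faces into one condition: the indicator of \<open>E\<close>, set to \<open>0\<close> on the boundary of the rectangle
  \<open>[0, 2m] \<times> [0, 2n]\<close>, solves the discrete wave equation modulo 2. Extending it to the plane by
  reflection, d'Alembert's formula writes it as \<open>g (a + b) + g (a - b)\<close> for a function \<open>g\<close> of the odd
  integers. The boundary conditions say that \<open>g\<close> is even and has periods \<open>4m\<close> and \<open>4n\<close>, hence \<open>4d\<close>,
  so \<open>g\<close> is given by its \<open>d\<close> free values at the odd numbers below \<open>2d\<close>. If \<open>u\<close> of these are \<open>1\<close> and
  \<open>v\<close> are \<open>0\<close>, then each of the \<open>m' n'\<close> blocks of side \<open>2d\<close> contributes \<open>4 u v\<close> edges: a pair of
  different values is met by the two diagonal billiard paths at exactly four points of a block.\<close>

section \<open>Edges as midpoints in doubled coordinates, and one parity condition for vertices and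
  faces\<close>

text \<open>The grid point \<open>(x, y)\<close> is placed at \<open>(2x - 1, 2y - 1)\<close>, so that cell \<open>(x, y)\<close> has its centre at
  \<open>(2x, 2y)\<close> and edge midpoints are the points whose coordinates have different parity.\<close>

definition edge_at :: "int \<times> int \<Rightarrow> (int \<times> int) set" where
  "edge_at = (\<lambda>(a, b). {((a + 1) div 2, (b + 1) div 2), ((a + 2) div 2, (b + 2) div 2)})"

definition sites :: "nat \<Rightarrow> nat \<Rightarrow> (int \<times> int) set" where
  "sites m n = {(a, b). 0 < a \<and> a < 2 * int m \<and> 0 < b \<and> b < 2 * int n \<and> odd (a + b)}"

text \<open>Around a point with both coordinates odd these are the midpoints of the edges at a
  vertex; around one with both even, the midpoints of the sides of a cell.\<close>

definition nbrs :: "int \<Rightarrow> int \<Rightarrow> (int \<times> int) set" where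
  "nbrs a b = {(a - 1, b), (a + 1, b), (a, b - 1), (a, b + 1)}"

lemma edge_at_simps:
  "edge_at (2 * x, 2 * y - 1) = {(x, y), (x + 1, y)}"
  "edge_at (2 * x, 2 * y + 1) = {(x, y + 1), (x + 1, y + 1)}"
  "edge_at (2 * x - 1, 2 * y) = {(x, y), (x, y + 1)}"
  "edge_at (2 * x + 1, 2 * y) = {(x + 1, y), (x + 1, y + 1)}"
proof -
  have [simp]: "(2 * x + 2) div 2 = x + 1" "(2 * x + 1) div 2 = x" "(2 * x + 3) div 2 = x + 1"
    "(2 * x - 1) div 2 = x - 1" for x :: int by auto
  show
    "edge_at (2 * x, 2 * y - 1) = {(x, y), (x + 1, y)}"
    "edge_at (2 * x, 2 * y + 1) = {(x, y + 1), (x + 1, y + 1)}"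
    "edge_at (2 * x - 1, 2 * y) = {(x, y), (x, y + 1)}"
    "edge_at (2 * x + 1, 2 * y) = {(x + 1, y), (x + 1, y + 1)}"
    by (simp_all add: edge_at_def add.commute)
qed

lemma odd_site_cases:
  fixes a b :: int
  assumes "odd (a + b)"
  obtains x y where "a = 2 * x" "b = 2 * y - 1" | x y where "a = 2 * x - 1" "b = 2 * y"
proof (cases "even a")
  case True
  then obtain x where "a = 2 * x" by blast
  moreover from True assms have "even (b + 1)" by auto
  then obtain y where "b + 1 = 2 * y" by blast
  ultimately show ?thesis using that(1)[of x y] by auto
next
  case False
  then have "even (a + 1)" by auto
  then obtain x where "a + 1 = 2 * x" by blast
  moreover from False assms have "even b" by auto
  then obtain y where "b = 2 * y" by blast
  ultimately show ?thesis using that(2)[of x y] by auto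
qed

lemma inj_on_edge_at: "inj_on edge_at {(a, b). odd (a + b)}"
proof (rule inj_onI, clarify)
  fix a b c e :: int
  assume "odd (a + b)" "odd (c + e)" "edge_at (a, b) = edge_at (c, e)"
  then show "a = c \<and> b = e"
    by (elim odd_site_cases) (auto simp: edge_at_simps doubleton_eq_iff)
qed

lemma edges_grid: "edges (grid m n) = edge_at ` sites m n"
proof
  show "edges (grid m n) \<subseteq> edge_at ` sites m n"
  proof
    fix e assume "e \<in> edges (grid m n)"
    then consider x y where "e = {(x, y), (x + 1, y)}" "1 \<le> x" "x + 1 \<le> int m" "1 \<le> y" "y \<le> int n"
      | x y where "e = {(x, y), (x, y + 1)}" "1 \<le> x" "x \<le> int m" "1 \<le> y" "y + 1 \<le> int n"
      unfolding grid_def by auto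
    then show "e \<in> edge_at ` sites m n"
    proof cases
      case 1
      then show ?thesis
        by (intro image_eqI[where x = "(2 * x, 2 * y - 1)"]) (auto simp: edge_at_simps sites_def)
    next
      case 2
      then show ?thesis
        by (intro image_eqI[where x = "(2 * x - 1, 2 * y)"]) (auto simp: edge_at_simps sites_def)
    qed
  qed
  show "edge_at ` sites m n \<subseteq> edges (grid m n)"
  proof (clarify)
    fix a b assume s: "(a, b) \<in> sites m n"
    then have "odd (a + b)" by (auto simp: sites_def)
    then show "edge_at (a, b) \<in> edges (grid m n)"
    proof (cases rule: odd_site_cases)
      case (1 x y)
      with s have "edge_at (a, b) = {(x, y), (x + 1, y)}"
        "1 \<le> x" "x + 1 \<le> int m" "1 \<le> y" "y \<le> int n"
        by (auto simp: edge_at_simps sites_def)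
      then show ?thesis unfolding grid_def by simp blast
    next
      case (2 x y)
      with s have "edge_at (a, b) = {(x, y), (x, y + 1)}"
        "1 \<le> x" "x \<le> int m" "1 \<le> y" "y + 1 \<le> int n"
        by (auto simp: edge_at_simps sites_def)
      then show ?thesis unfolding grid_def by simp blast
    qed
  qed
qed

lemma edge_at_nbrs_cell: "edge_at ` nbrs (2 * x) (2 * y) = cell_boundary x y"
  by (auto simp: nbrs_def cell_boundary_def edge_at_simps)

lemma mem_edge_at_iff:
  assumes "odd (a + b)"
  shows "(x, y) \<in> edge_at (a, b) \<longleftrightarrow> (a, b) \<in> nbrs (2 * x - 1) (2 * y - 1)"
  using assms by (cases rule: odd_site_cases) (auto simp: edge_at_simps nbrs_def; presburger)+

text \<open>Injectivity of \<open>edge_at\<close> turns counts of edges into counts of midpoints.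
  The points with \<open>a + b\<close> even are the vertices (both odd) and the cell centres (both
  even). At a vertex on the border, neighbours outside \<open>sites\<close> do not count because
  \<open>S\<close> avoids them.\<close>

lemma totally_even_edge_at_iff:
  assumes S: "S \<subseteq> sites m n"
  shows "totally_even (grid m n) (edge_at ` S) \<longleftrightarrow>
    (\<forall>a b. 0 < a \<and> a < 2 * int m \<and> 0 < b \<and> b < 2 * int n \<and> even (a + b) \<longrightarrow>
           even (card (S \<inter> nbrs a b)))" (is "_ \<longleftrightarrow> ?R")
proof -
  have S': "S \<subseteq> {(a, b). odd (a + b)}" using S by (auto simp: sites_def)
  have card_nbrs: "card (edge_at ` S \<inter> edge_at ` nbrs a b) = card (S \<inter> nbrs a b)"
    if "even (a + b)" for a b
  proof -
    have N: "nbrs a b \<subseteq> {(a, b). odd (a + b)}"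
      using that by (auto simp: nbrs_def)
    have "edge_at ` S \<inter> edge_at ` nbrs a b = edge_at ` (S \<inter> nbrs a b)"
      using inj_on_image_Int[OF inj_on_edge_at S' N] by simp
    moreover have "inj_on edge_at (S \<inter> nbrs a b)"
      using inj_on_subset[OF inj_on_edge_at] S' by blast
    ultimately show ?thesis by (simp add: card_image)
  qed
  have face: "card (edge_at ` S \<inter> cell_boundary x y) = card (S \<inter> nbrs (2 * x) (2 * y))" for x y
    using card_nbrs[of "2 * x" "2 * y"] by (simp add: edge_at_nbrs_cell)
  have vertex: "card {e \<in> edge_at ` S. (x, y) \<in> e} = card (S \<inter> nbrs (2 * x - 1) (2 * y - 1))" for x y
  proof -
    have "(x, y) \<in> edge_at z \<longleftrightarrow> z \<in> nbrs (2 * x - 1) (2 * y - 1)" if "z \<in> S" for z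
      using that S' mem_edge_at_iff by (cases z) auto
    then have "{e \<in> edge_at ` S. (x, y) \<in> e} = edge_at ` (S \<inter> nbrs (2 * x - 1) (2 * y - 1))"
      by auto
    moreover have "inj_on edge_at (S \<inter> nbrs (2 * x - 1) (2 * y - 1))"
      using inj_on_subset[OF inj_on_edge_at] S' by blast
    ultimately show ?thesis by (simp add: card_image)
  qed
  have "edge_at ` S \<subseteq> edges (grid m n)"
    using S by (auto simp: edges_grid)
  then have "totally_even (grid m n) (edge_at ` S) \<longleftrightarrow>
    (\<forall>x y. 1 \<le> x \<and> x \<le> int m \<and> 1 \<le> y \<and> y \<le> int n \<longrightarrow>
       even (card (S \<inter> nbrs (2 * x - 1) (2 * y - 1)))) \<and>
    (\<forall>x y. 1 \<le> x \<and> x + 1 \<le> int m \<and> 1 \<le> y \<and> y + 1 \<le> int n \<longrightarrow>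
       even (card (S \<inter> nbrs (2 * x) (2 * y))))"
    unfolding totally_even_def face[symmetric] vertex[symmetric] by (simp add: grid_def) blast
  also have "\<dots> \<longleftrightarrow> ?R"
  proof (intro iffI conjI allI impI)
    fix a b :: int
    assume H: "(\<forall>x y. 1 \<le> x \<and> x \<le> int m \<and> 1 \<le> y \<and> y \<le> int n \<longrightarrow>
       even (card (S \<inter> nbrs (2 * x - 1) (2 * y - 1)))) \<and>
    (\<forall>x y. 1 \<le> x \<and> x + 1 \<le> int m \<and> 1 \<le> y \<and> y + 1 \<le> int n \<longrightarrow>
       even (card (S \<inter> nbrs (2 * x) (2 * y))))"
    assume ab: "0 < a \<and> a < 2 * int m \<and> 0 < b \<and> b < 2 * int n \<and> even (a + b)"
    show "even (card (S \<inter> nbrs a b))"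
    proof (cases "even a")
      case True
      with ab have "even b" by auto
      with True obtain x y where "a = 2 * x" "b = 2 * y" by blast
      with H ab show ?thesis by auto
    next
      case False
      with ab have "even (a + 1)" "even (b + 1)" by auto
      then obtain x y where "a + 1 = 2 * x" "b + 1 = 2 * y" by (meson evenE)
      then have "a = 2 * x - 1" "b = 2 * y - 1" by auto
      with H ab show ?thesis by auto
    qed
  qed auto
  finally show ?thesis .
qed

text \<open>Four bits sum to 0 modulo 2 exactly when the horizontal pair and the vertical pair have
  equal sums. This is the form of the wave equation used from here on.\<close>

lemma even_card_Int_nbrs_iff:
  "even (card (S \<inter> nbrs a b)) \<longleftrightarrow>
   (((a - 1, b) \<in> S \<longleftrightarrow> (a + 1, b) \<in> S) \<longleftrightarrow> ((a, b - 1) \<in> S \<longleftrightarrow> (a, b + 1) \<in> S))"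
  unfolding nbrs_def by (simp add: Int_insert_right)

section \<open>Folding the integers onto an interval by reflections\<close>

text \<open>For \<open>N > 0\<close> this is the distance from \<open>a\<close> to the nearest
  multiple of \<open>2 * N\<close>: the triangle wave that folds the line onto \<open>[0, N]\<close>
  by reflecting at the multiples of \<open>N\<close>.\<close>

definition fold_int :: "int \<Rightarrow> int \<Rightarrow> int" where
  "fold_int N a = min (a mod (2 * N)) (2 * N - a mod (2 * N))"

lemma fold_int_add_multiple [simp]: "fold_int N (a + 2 * N * k) = fold_int N a"
  by (simp add: fold_int_def)

lemma fold_int_eq:
  fixes a N :: int
  assumes "N > 0" "- N \<le> a" "a \<le> 2 * N"
  shows "fold_int N a = (if a \<le> 0 then - a else if a \<le> N then a else 2 * N - a)"
proof -
  consider "a < 0" | "0 \<le> a" "a < 2 * N" | "a = 2 * N" using assms by linarith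
  then show ?thesis
  proof cases
    case 1
    have "a mod (2 * N) = (a + 2 * N) mod (2 * N)" by simp
    also have "\<dots> = a + 2 * N" using 1 assms by (intro mod_pos_pos_trivial) auto
    finally show ?thesis using 1 assms by (simp add: fold_int_def)
  next
    case 2
    then show ?thesis using assms by (simp add: fold_int_def)
  next
    case 3
    then show ?thesis using assms by (simp add: fold_int_def)
  qed
qed

lemma fold_int_rep:
  fixes a N :: int
  assumes "N > 0"
  obtains k r where "a = r + 2 * N * k" "- N < r" "r \<le> N"
proof -
  define k r where "k = a div (2 * N)" and "r = a mod (2 * N)"
  have a: "a = r + 2 * N * k" unfolding k_def r_def by simp
  have "0 \<le> r" "r < 2 * N" using assms by (simp_all add: r_def)
  then show ?thesis
    using a assms that[of r k] that[of "r - 2 * N" "k + 1"]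
    by (cases "r \<le> N") (auto simp: algebra_simps)
qed

text \<open>Modulo \<open>2 * N\<close> one may take a representative \<open>r\<close> with - N < r
  \<le> N, where folding is the absolute value; only \<open>r + 1\<close> for \<open>r = N\<close>
  falls outside and comes back as \<open>N - 1\<close>. These facts carry the wave equation from the
  rectangle to the plane.\<close>

lemma fold_int_nbrs:
  assumes "N > 0"
  shows "fold_int N a = 0 \<or> fold_int N a = N \<Longrightarrow> fold_int N (a - 1) = fold_int N (a + 1)"
    and "0 \<le> fold_int N a" "fold_int N a \<le> N"
    and "0 < fold_int N a \<Longrightarrow> fold_int N a < N \<Longrightarrow>
         fold_int N (a - 1) = fold_int N a - 1 \<and> fold_int N (a + 1) = fold_int N a + 1 \<or>
         fold_int N (a - 1) = fold_int N a + 1 \<and> fold_int N (a + 1) = fold_int N a - 1"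
    and "even (fold_int N a) \<longleftrightarrow> even a"
    and "fold_int N (- a) = fold_int N a"
proof -
  obtain k r where a: "a = r + 2 * N * k" and r: "- N < r" "r \<le> N"
    using fold_int_rep[OF assms] .
  have eq: "fold_int N a = fold_int N r" "fold_int N (a - 1) = fold_int N (r - 1)"
    "fold_int N (a + 1) = fold_int N (r + 1)" "fold_int N (- a) = fold_int N (- r)"
    using fold_int_add_multiple[of N r k] fold_int_add_multiple[of N "r - 1" k]
      fold_int_add_multiple[of N "r + 1" k] fold_int_add_multiple[of N "- r" "- k"]
    by (simp_all add: a algebra_simps)
  have r1: "fold_int N r = \<bar>r\<bar>" "fold_int N (- r) = \<bar>r\<bar>" "fold_int N (r - 1) = \<bar>r - 1\<bar>"
    "fold_int N (r + 1) = (if r = N then N - 1 else \<bar>r + 1\<bar>)"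
    using r assms by (auto simp: fold_int_eq)
  show "fold_int N a = 0 \<or> fold_int N a = N \<Longrightarrow> fold_int N (a - 1) = fold_int N (a + 1)"
    "0 \<le> fold_int N a" "fold_int N a \<le> N"
    "0 < fold_int N a \<Longrightarrow> fold_int N a < N \<Longrightarrow>
         fold_int N (a - 1) = fold_int N a - 1 \<and> fold_int N (a + 1) = fold_int N a + 1 \<or>
         fold_int N (a - 1) = fold_int N a + 1 \<and> fold_int N (a + 1) = fold_int N a - 1"
    "fold_int N (- a) = fold_int N a"
    unfolding eq r1 using r assms by (auto split: if_splits)
  show "even (fold_int N a) \<longleftrightarrow> even a"
    unfolding eq r1 by (simp add: a)
qed

section \<open>The discrete d'Alembert formula modulo 2\<close>

lemma int_const_of_step:
  fixes h :: "int \<Rightarrow> 'a"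
  assumes "\<And>p. h (p + 1) = h p"
  shows "h p = h 0"
proof (induction p rule: int_induct[where k = 0])
  case (step2 i)
  then show ?case using assms[of "i - 1"] by simp
qed (simp_all add: assms)

text \<open>The mixed second difference of \<open>H\<close> vanishes, so its difference in
  \<open>p\<close> does not depend on \<open>q\<close>. Hence \<open>H p q\<close> and
  \<open>H p 0\<close> differ by something independent of \<open>p\<close>.\<close>

lemma dAlembert_mod_2:
  fixes H :: "int \<Rightarrow> int \<Rightarrow> bool"
  assumes H: "\<And>p q. (H p q \<longleftrightarrow> H (p + 1) (q + 1)) \<longleftrightarrow> (H (p + 1) q \<longleftrightarrow> H p (q + 1))"
  shows "(H p q \<longleftrightarrow> H 0 0) \<longleftrightarrow> (H p 0 \<longleftrightarrow> H 0 q)"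
proof -
  have 1: "(H (p + 1) q \<longleftrightarrow> H p q) = (H (p + 1) 0 \<longleftrightarrow> H p 0)" for p
    using int_const_of_step[of "\<lambda>q. H (p + 1) q \<longleftrightarrow> H p q" q] H by blast
  have "(H p q \<longleftrightarrow> H p 0) = (H 0 q \<longleftrightarrow> H 0 0)"
    by (rule int_const_of_step[of "\<lambda>p. H p q \<longleftrightarrow> H p 0"]) (use 1 in blast)
  then show ?thesis by blast
qed

text \<open>The function \<open>g\<close> of the odd integers is encoded as \<open>G p = g (2p + 1)\<close>, so evenness of \<open>g\<close>
  reads \<open>G (- 1 - p) = G p\<close>.\<close>

definition dAlembert :: "(int \<Rightarrow> bool) \<Rightarrow> int \<Rightarrow> int \<Rightarrow> bool" where
  "dAlembert G a b \<longleftrightarrow> odd (a + b) \<and> G ((a + b) div 2) \<noteq> G ((a - b) div 2)"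

lemma ex_profile:
  assumes S: "S \<subseteq> sites m n" and "m > 0" "n > 0"
    and te: "totally_even (grid m n) (edge_at ` S)"
  obtains G where "\<And>p. G (- 1 - p) = G p" "\<And>p. G (p + 2 * int m) = G p"
    "\<And>p. G (p + 2 * int n) = G p"
    "S = {(a, b) \<in> sites m n. dAlembert G a b}"
proof -
  define M N where "M = 2 * int m" and "N = 2 * int n"
  have MN: "M > 0" "N > 0" "even M" "even N" using assms by (auto simp: M_def N_def)
  have out: "(a, b) \<notin> S" if "a = 0 \<or> a = M \<or> b = 0 \<or> b = N \<or> even (a + b)" for a b
    using S that by (auto simp: sites_def M_def N_def)
  \<comment> \<open>Modulo 2 there is no sign, so the plain reflection across the frame is also the
    odd reflection that zero boundary values call for.\<close>
  define F where "F a b \<longleftrightarrow> (fold_int M a, fold_int N b) \<in> S" for a b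
  have in_eq: "((a - 1, b) \<in> S \<longleftrightarrow> (a + 1, b) \<in> S) \<longleftrightarrow> ((a, b - 1) \<in> S \<longleftrightarrow> (a, b + 1) \<in> S)"
    if "0 < a" "a < M" "0 < b" "b < N" "even (a + b)" for a b
    using te that S unfolding totally_even_edge_at_iff[OF S] even_card_Int_nbrs_iff M_def N_def
    by blast
  have wave: "(F (a - 1) b \<longleftrightarrow> F (a + 1) b) \<longleftrightarrow> (F a (b - 1) \<longleftrightarrow> F a (b + 1))"
    if ev: "even (a + b)" for a b
  proof -
    note a = fold_int_nbrs[OF MN(1), of a] and b = fold_int_nbrs[OF MN(2), of b]
    \<comment> \<open>On a mirror line the two neighbours across it have equal values, and the two
      along it lie on the frame, outside \<open>S\<close>. Elsewhere the neighbours fold to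
      neighbours, at most with opposite ones swapped.\<close>
    consider "fold_int M a = 0 \<or> fold_int M a = M" | "fold_int N b = 0 \<or> fold_int N b = N"
      | "0 < fold_int M a" "fold_int M a < M" "0 < fold_int N b" "fold_int N b < N"
      using a(2,3) b(2,3) by linarith
    then show ?thesis
    proof cases
      case 1
      with a(1) show ?thesis unfolding F_def by (auto simp: out)
    next
      case 2
      with b(1) show ?thesis unfolding F_def by (auto simp: out)
    next
      case 3
      have "even (fold_int M a + fold_int N b)" using ev a(5) b(5) by simp
      from in_eq[OF 3 this] a(4)[OF 3(1,2)] b(4)[OF 3(3,4)] show ?thesis
        unfolding F_def by auto
    qed
  qed
  \<comment> \<open>Characteristic coordinates: with \<open>a = p + q + 1\<close> and
    \<open>b = p - q\<close>, the sum \<open>a + b\<close> is \<open>2 * p + 1\<close> and the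
    difference \<open>a - b\<close> is \<open>2 * q + 1\<close>.\<close>
  define H where "H p q = F (p + q + 1) (p - q)" for p q
  \<comment> \<open>The values of \<open>H\<close> on the characteristic \<open>q = 0\<close>. The
    term \<open>H 0 0\<close> is \<open>F 1 0\<close>, which vanishes on the frame, and
    \<open>H 0 q\<close> equals \<open>H q 0\<close> by reflection in \<open>b\<close>.\<close>
  define G where "G p = F (p + 1) p" for p
  have F0: "\<not> F a 0" "\<not> F 0 b" "\<not> F M b" "\<not> F a N" for a b
    using MN out by (auto simp: F_def fold_int_eq)
  have Fneg: "F a (- b) = F a b" for a b
    using fold_int_nbrs(6)[OF MN(2)] by (simp add: F_def)
  have "H p q \<longleftrightarrow> G p \<noteq> G q" for p q
  proof -
    have "(H p q \<longleftrightarrow> H 0 0) \<longleftrightarrow> (H p 0 \<longleftrightarrow> H 0 q)"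
    proof (rule dAlembert_mod_2)
      fix p q
      show "(H p q \<longleftrightarrow> H (p + 1) (q + 1)) \<longleftrightarrow> (H (p + 1) q \<longleftrightarrow> H p (q + 1))"
        using wave[of "p + q + 2" "p - q"] unfolding H_def by (auto simp: algebra_simps)
    qed
    moreover have "H p 0 = G p" by (simp add: H_def G_def)
    moreover have "H 0 q = G q" using Fneg[of "q + 1" q] by (simp add: H_def G_def)
    moreover have "\<not> H 0 0" by (simp add: H_def F0)
    ultimately show ?thesis by blast
  qed
  then have FG: "F (p + q + 1) (p - q) \<longleftrightarrow> G p \<noteq> G q" for p q
    by (simp add: H_def)
  \<comment> \<open>Each zero line of \<open>F\<close> yields one symmetry: here
    \<open>a = 0\<close>, then \<open>a = M\<close> combined with evenness, then
    \<open>b = N\<close>.\<close>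
  have refl: "G (- 1 - p) = G p" for p
    using FG[of p "- 1 - p"] F0 by simp
  have pm: "G (p + 2 * int m) = G p" for p
    using FG[of "p + M" "- 1 - p"] F0 refl[of p] by (simp add: M_def)
  have pn: "G (p + 2 * int n) = G p" for p
    using FG[of "p + N" p] F0 by (simp add: N_def)
  have "(a, b) \<in> S \<longleftrightarrow> dAlembert G a b" if ab: "(a, b) \<in> sites m n" for a b
  proof -
    have b: "0 < a" "a < M" "0 < b" "b < N" "odd (a + b)"
      using ab by (auto simp: sites_def M_def N_def)
    then have "(a, b) \<in> S \<longleftrightarrow> F a b" by (simp add: F_def fold_int_eq)
    also have "\<dots> \<longleftrightarrow> dAlembert G a b"
    proof -
      have "(a + b) div 2 + (a - b) div 2 + 1 = a" "(a + b) div 2 - (a - b) div 2 = b"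
        using b(5) by presburger+
      with FG[of "(a + b) div 2" "(a - b) div 2"] b(5) show ?thesis by (simp add: dAlembert_def)
    qed
    finally show ?thesis .
  qed
  with S have "S = {(a, b) \<in> sites m n. dAlembert G a b}" by auto
  with refl pm pn that show ?thesis by blast
qed

section \<open>The converse: symmetries and zeros of a solution built from a profile\<close>

text \<open>The four neighbours involve only the values of \<open>G\<close> at \<open>p\<close>,
  \<open>p - 1\<close>, \<open>q\<close> and \<open>q - 1\<close>, and each value occurs in exactly
  two of them, so all cancel modulo 2.\<close>

lemma dAlembert_wave:
  assumes "even (a + b)"
  shows "(dAlembert G (a - 1) b \<longleftrightarrow> dAlembert G (a + 1) b) \<longleftrightarrow>
    (dAlembert G a (b - 1) \<longleftrightarrow> dAlembert G a (b + 1))"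
proof -
  define p q where "p = (a + b) div 2" and "q = (a - b) div 2"
  have "a = p + q" "b = p - q" using assms unfolding p_def q_def by presburger+
  then have "(a - 1 + b) div 2 = p - 1" "(a + 1 + b) div 2 = p"
    "(a - 1 - b) div 2 = q - 1" "(a + 1 - b) div 2 = q"
    "(a + (b - 1)) div 2 = p - 1" "(a + (b + 1)) div 2 = p"
    "(a - (b - 1)) div 2 = q" "(a - (b + 1)) div 2 = q - 1"
    by presburger+
  moreover have "odd (a - 1 + b)" "odd (a + 1 + b)" "odd (a + (b - 1))" "odd (a + (b + 1))"
    using assms by presburger+
  ultimately show ?thesis unfolding dAlembert_def by (simp only:) blast
qed

lemma dAlembert_minus:
  assumes "\<And>p. G (- 1 - p) = G p"
  shows "dAlembert G (- a) b = dAlembert G a b" "dAlembert G a (- b) = dAlembert G a b"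
proof -
  have "odd (a + b) \<Longrightarrow> (- a + b) div 2 = - 1 - (a - b) div 2"
    "odd (a + b) \<Longrightarrow> (- a - b) div 2 = - 1 - (a + b) div 2" by presburger+
  then have "odd (a + b) \<Longrightarrow> G ((- a + b) div 2) = G ((a - b) div 2)"
    "odd (a + b) \<Longrightarrow> G ((- a - b) div 2) = G ((a + b) div 2)"
    using assms by metis+
  moreover have "odd (- a + b) \<longleftrightarrow> odd (a + b)" by auto
  ultimately show "dAlembert G (- a) b = dAlembert G a b" unfolding dAlembert_def by blast
qed (auto simp: dAlembert_def)

lemma dAlembert_add:
  assumes "\<And>p. G (p + 2 * d) = G p"
  shows "dAlembert G (a + 4 * d) b = dAlembert G a b" "dAlembert G a (b + 4 * d) = dAlembert G a b"
proof -
  have "(a + 4 * d + b) div 2 = (a + b) div 2 + 2 * d"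
    "(a + 4 * d - b) div 2 = (a - b) div 2 + 2 * d"
    "(a + (b + 4 * d)) div 2 = (a + b) div 2 + 2 * d"
    "(a - (b + 4 * d)) div 2 = (a - b) div 2 - 2 * d" by presburger+
  moreover have "G (p - 2 * d) = G p" for p using assms[of "p - 2 * d"] by simp
  ultimately show "dAlembert G (a + 4 * d) b = dAlembert G a b" "dAlembert G a (b + 4 * d) = dAlembert G a b"
    unfolding dAlembert_def using assms by simp_all
qed

lemma dAlembert_zero:
  assumes "\<And>p. G (- 1 - p) = G p"
  shows "\<not> dAlembert G 0 b" "\<not> dAlembert G a 0"
proof -
  have "odd b \<Longrightarrow> - b div 2 = - 1 - b div 2" by presburger
  then have "odd b \<Longrightarrow> G (- b div 2) = G (b div 2)"
    using assms by metis
  then show "\<not> dAlembert G 0 b" "\<not> dAlembert G a 0" by (auto simp: dAlembert_def)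
qed

text \<open>Evenness and period together make the profile symmetric about \<open>2 * d\<close>. On
  the line \<open>a = 2 * d\<close> the two arguments \<open>2 * d + b\<close> and
  \<open>2 * d - b\<close> are mirror images; on \<open>b = 2 * d\<close> they differ by the full
  period \<open>4 * d\<close>.\<close>

lemma dAlembert_half_period:
  assumes refl: "\<And>p. G (- 1 - p) = G p" and per: "\<And>p. G (p + 2 * d) = G p"
  shows "\<not> dAlembert G (2 * d) b" "\<not> dAlembert G a (2 * d)"
proof -
  have refl': "G (d + p) = G (d - 1 - p)" for p
    using per[of "- 1 - (d + p)"] refl[of "d + p"] by (simp add: algebra_simps)
  have "(2 * d + b) div 2 = d + b div 2" by simp
  moreover have "odd b \<Longrightarrow> (2 * d - b) div 2 = d - 1 - b div 2" by presburger
  ultimately have "odd b \<Longrightarrow> G ((2 * d + b) div 2) = G ((2 * d - b) div 2)"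
    using refl' by metis
  then show "\<not> dAlembert G (2 * d) b" by (auto simp: dAlembert_def)
  have "(a + 2 * d) div 2 = (a - 2 * d) div 2 + 2 * d" by presburger
  then show "\<not> dAlembert G a (2 * d)" unfolding dAlembert_def using per by metis
qed

section \<open>Counting: reduction to a square block, and the count in one block\<close>

text \<open>Adding the row and column at 0, where the indicator vanishes, yields half-open ranges,
  which can be cut into blocks without overlap.\<close>

lemma card_sites_dAlembert:
  assumes "\<And>p. G (- 1 - p) = G p"
  shows "card {(a, b) \<in> sites m n. dAlembert G a b} =
    (\<Sum>a\<in>{0..<2 * int m}. \<Sum>b\<in>{0..<2 * int n}. of_bool (dAlembert G a b))"
proof -
  have "{(a, b) \<in> sites m n. dAlembert G a b} =
    (SIGMA a:{0..<2 * int m}. {0..<2 * int n} \<inter> Collect (dAlembert G a))" (is "?L = ?R")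
  proof (intro set_eqI, clarify)
    fix a b
    have "dAlembert G a b \<Longrightarrow> a \<noteq> 0 \<and> b \<noteq> 0"
      using dAlembert_zero[of G, OF assms] by metis
    moreover have "dAlembert G a b \<Longrightarrow> odd (a + b)" by (simp add: dAlembert_def)
    ultimately show "(a, b) \<in> ?L \<longleftrightarrow> (a, b) \<in> ?R"
      by (cases "dAlembert G a b") (auto simp: sites_def)
  qed
  then show ?thesis by (simp add: card_SigmaI of_bool_def sum.If_cases)
qed

text \<open>Consecutive blocks of length \<open>D\<close> are alternately translates and mirror
  images of the first one, so all have the same sum.\<close>

lemma sum_reflection:
  fixes \<phi> :: "int \<Rightarrow> nat" and D k :: nat
  assumes minus: "\<And>x. \<phi> (- x) = \<phi> x" and per: "\<And>x. \<phi> (x + 2 * int D) = \<phi> x"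
    and ends: "\<phi> 0 = \<phi> (int D)"
  shows "(\<Sum>x\<in>{0..<int (D * k)}. \<phi> x) = k * (\<Sum>x\<in>{0..<int D}. \<phi> x)"
proof (induction k)
  case (Suc k)
  have per': "\<phi> (x + 2 * int D * j) = \<phi> x" for x j
    using int_const_of_step[of "\<lambda>j. \<phi> (x + 2 * int D * j)" j] per[of "x + 2 * int D * i" for i]
    by (simp add: algebra_simps)
  have block: "(\<Sum>x\<in>{int (D * k)..<int (D * k) + int D}. \<phi> x) = (\<Sum>x\<in>{0..<int D}. \<phi> x)"
  proof (cases "even k")
    case True
    then obtain j where k: "k = 2 * j" by blast
    have "\<phi> (x - 2 * int D * int j) = \<phi> x" for x
      using per'[of x "- int j"] by simp
    then show ?thesis
      by (intro sum.reindex_bij_witness[where i = "\<lambda>x. x + 2 * int D * int j"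
            and j = "\<lambda>x. x - 2 * int D * int j"])
        (auto simp: k algebra_simps)
  next
    case False
    then have "even (Suc k)" by simp
    then obtain j where "Suc k = 2 * j" by blast
    then have "int k = 2 * int j - 1" by linarith
    then have k: "int (D * k) = 2 * int D * int j - int D"
      by (simp add: right_diff_distrib mult.left_commute)
    have refl: "\<phi> (2 * int D * int j - x) = \<phi> x" for x
      using per'[of "- x" "int j"] minus by (simp add: algebra_simps)
    \<comment> \<open>The mirror image of a block closed on the left is closed on the right;
      \<open>ends\<close> lets the value at \<open>D\<close> be traded for the one at 0.\<close>
    have "(\<Sum>x\<in>{int (D * k)..<int (D * k) + int D}. \<phi> x) = (\<Sum>x\<in>{0<..int D}. \<phi> x)"
      unfolding k using refl
      by (intro sum.reindex_bij_witness[where i = "\<lambda>x. 2 * int D * int j - x"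
            and j = "\<lambda>x. 2 * int D * int j - x"]) auto
    also have "\<dots> = (\<Sum>x\<in>{0..<int D}. \<phi> x)"
    proof (cases "D = 0")
      case False
      then have "{0<..int D} = insert (int D) {0<..<int D}" "{0..<int D} = insert 0 {0<..<int D}"
        by auto
      then show ?thesis by (simp add: ends)
    qed simp
    finally show ?thesis .
  qed
  have "{0..<int (D * Suc k)} = {0..<int (D * k)} \<union> {int (D * k)..<int (D * k) + int D}"
    using ivl_disj_un_two(3)[of 0 "int (D * k)" "int (D * k) + int D"]
    by (simp add: algebra_simps)
  then have "(\<Sum>x\<in>{0..<int (D * Suc k)}. \<phi> x) =
    (\<Sum>x\<in>{0..<int (D * k)}. \<phi> x) + (\<Sum>x\<in>{int (D * k)..<int (D * k) + int D}. \<phi> x)"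
    by (simp add: sum.union_disjoint)
  with Suc block show ?case by simp
qed simp

text \<open>In the coordinates \<open>p\<close>, \<open>q\<close> a point of the block folds to a
  pair \<open>lo < hi\<close> of indices below \<open>d\<close>, and it is counted when
  \<open>G\<close> separates the pair. Each such pair arises from four points: \<open>p\<close> is
  \<open>hi\<close> or its mirror image about the half period, \<open>q\<close> is \<open>lo\<close>
  or its mirror image about 0.\<close>

lemma card_block_dAlembert:
  fixes G :: "int \<Rightarrow> bool" and d :: nat
  assumes refl: "\<And>p. G (- 1 - p) = G p" and per: "\<And>p. G (p + 2 * int d) = G p"
  shows "card {(a, b) \<in> sites d d. dAlembert G a b} =
    4 * card {p \<in> {0..<int d}. G p} * card {p \<in> {0..<int d}. \<not> G p}"
proof -
  define U V where "U = {p \<in> {0..<int d}. G p}" and "V = {p \<in> {0..<int d}. \<not> G p}"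
  have per': "G (2 * int d - 1 - p) = G p" for p
    using per[of "- 1 - p"] refl[of p] by (simp add: algebra_simps)
  \<comment> \<open>The flags \<open>s\<close> and \<open>t\<close> select the mirror images. Taking
    \<open>max\<close> and \<open>min\<close> loses no information: since \<open>U\<close> and
    \<open>V\<close> are disjoint, membership tells which of the two indices came from
    \<open>U\<close>.\<close>
  define P where "P = (\<lambda>(i, j, s, t).
    (if s then max i j else 2 * int d - 1 - max i j, if t then min i j else - 1 - min i j))"
  have "inj_on P (U \<times> V \<times> UNIV \<times> UNIV)"
  proof (rule inj_onI, simp only: split_paired_all)
    fix i j s t i' j' s' t'
    assume "(i, j, s, t) \<in> U \<times> V \<times> UNIV \<times> UNIV" "(i', j', s', t') \<in> U \<times> V \<times> UNIV \<times> UNIV"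
      and eq: "P (i, j, s, t) = P (i', j', s', t')"
    then have m: "i \<in> U" "j \<in> V" "i' \<in> U" "j' \<in> V" by auto
    then have "0 \<le> i" "i < int d" "0 \<le> j" "j < int d" "0 \<le> i'" "i' < int d" "0 \<le> j'" "j' < int d"
      by (auto simp: U_def V_def)
    with eq have "max i j = max i' j' \<and> min i j = min i' j' \<and> s = s' \<and> t = t'"
      unfolding P_def by (auto split: if_splits)
    moreover from this have "i = i' \<and> j = j' \<or> i = j' \<and> j = i'" by linarith
    ultimately show "(i, j, s, t) = (i', j', s', t')"
      using m by (auto simp: U_def V_def)
  qed
  then have card_P: "card (P ` (U \<times> V \<times> UNIV \<times> UNIV)) = 4 * card U * card V"
    by (simp add: card_image card_cartesian_product del: UNIV_Times_UNIV)
  have "bij_betw (\<lambda>(p, q). (p + q + 1, p - q)) (P ` (U \<times> V \<times> UNIV \<times> UNIV))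
    {(a, b) \<in> sites d d. dAlembert G a b}"
  proof (rule bij_betw_byWitness[where f' = "\<lambda>(a, b). ((a + b) div 2, (a - b) div 2)"])
    show "\<forall>z\<in>P ` (U \<times> V \<times> UNIV \<times> UNIV).
      (\<lambda>(a, b). ((a + b) div 2, (a - b) div 2)) ((\<lambda>(p, q). (p + q + 1, p - q)) z) = z"
    proof
      fix z :: "int \<times> int"
      obtain p q where z: "z = (p, q)" by fastforce
      have "p + q + 1 + (p - q) = 2 * p + 1" "p + q + 1 - (p - q) = 2 * q + 1" by auto
      then show "(\<lambda>(a, b). ((a + b) div 2, (a - b) div 2)) ((\<lambda>(p, q). (p + q + 1, p - q)) z) = z"
        by (simp add: z)
    qed
    show "\<forall>z\<in>{(a, b) \<in> sites d d. dAlembert G a b}.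
      (\<lambda>(p, q). (p + q + 1, p - q)) ((\<lambda>(a, b). ((a + b) div 2, (a - b) div 2)) z) = z"
    proof
      fix z assume "z \<in> {(a, b) \<in> sites d d. dAlembert G a b}"
      then obtain a b where z: "z = (a, b)" and "dAlembert G a b" by auto
      then have "odd (a + b)" by (simp add: dAlembert_def)
      then have "(a + b) div 2 + (a - b) div 2 + 1 = a" "(a + b) div 2 - (a - b) div 2 = b"
        by presburger+
      then show "(\<lambda>(p, q). (p + q + 1, p - q)) ((\<lambda>(a, b). ((a + b) div 2, (a - b) div 2)) z) = z"
        by (simp add: z)
    qed
    show "(\<lambda>(p, q). (p + q + 1, p - q)) ` P ` (U \<times> V \<times> UNIV \<times> UNIV)
      \<subseteq> {(a, b) \<in> sites d d. dAlembert G a b}"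
    proof
      fix z assume "z \<in> (\<lambda>(p, q). (p + q + 1, p - q)) ` P ` (U \<times> V \<times> UNIV \<times> UNIV)"
      then obtain i j s t where ij: "i \<in> U" "j \<in> V"
        and z': "z = (\<lambda>(p, q). (p + q + 1, p - q)) (P (i, j, s, t))" by blast
      obtain p q where pq: "P (i, j, s, t) = (p, q)" by fastforce
      with z' have z: "z = (p + q + 1, p - q)" by simp
      define hi lo where "hi = max i j" and "lo = min i j"
      have 1: "0 \<le> lo" "lo < hi" "hi < int d" "G hi \<noteq> G lo"
        using ij by (auto simp: U_def V_def hi_def lo_def max_def min_def order.order_iff_strict)
      have p: "p = hi \<or> p = 2 * int d - 1 - hi" and q: "q = lo \<or> q = - 1 - lo"
        using pq by (auto simp: P_def hi_def lo_def)
      have "G p = G hi" "G q = G lo" using p q refl per' by auto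
      moreover have "p + q + 1 + (p - q) = 2 * p + 1" "p + q + 1 - (p - q) = 2 * q + 1" by auto
      ultimately have "dAlembert G (p + q + 1) (p - q)" using 1 by (simp add: dAlembert_def)
      moreover have "(p + q + 1, p - q) \<in> sites d d"
        using 1 p q by (auto simp: sites_def)
      ultimately show "z \<in> {(a, b) \<in> sites d d. dAlembert G a b}" by (simp add: z)
    qed
    show "(\<lambda>(a, b). ((a + b) div 2, (a - b) div 2)) ` {(a, b) \<in> sites d d. dAlembert G a b}
      \<subseteq> P ` (U \<times> V \<times> UNIV \<times> UNIV)"
    proof
      fix z
      assume "z \<in> (\<lambda>(a, b). ((a + b) div 2, (a - b) div 2)) `
        {(a, b) \<in> sites d d. dAlembert G a b}"
      then obtain a b where ab: "(a, b) \<in> sites d d" and dAlembert: "dAlembert G a b"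
        and z: "z = ((a + b) div 2, (a - b) div 2)" by auto
      define p q where "p = (a + b) div 2" and "q = (a - b) div 2"
      have "odd (a + b)" using dAlembert by (simp add: dAlembert_def)
      then have "a = p + q + 1" "b = p - q" unfolding p_def q_def by presburger+
      then have r: "- 1 < p + q" "p + q + 1 < 2 * int d" "q < p" "p - q < 2 * int d"
        using ab by (auto simp: sites_def)
      define s t where "s \<longleftrightarrow> p < int d" and "t \<longleftrightarrow> 0 \<le> q"
      define hi lo where "hi = (if s then p else 2 * int d - 1 - p)"
        and "lo = (if t then q else - 1 - q)"
      \<comment> \<open>The four sides of the square, rewritten as the four inequalities in
        \<open>r\<close>, give \<open>lo < hi\<close> in the four cases of \<open>s\<close> and
        \<open>t\<close>, one side for each case.\<close>
      have hl: "0 \<le> lo" "lo < hi" "hi < int d" using r by (auto simp: hi_def lo_def s_def t_def)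
      have "G hi = G p" "G lo = G q" using per' refl by (auto simp: hi_def lo_def)
      then have G: "G hi \<noteq> G lo" using dAlembert by (simp add: dAlembert_def p_def q_def)
      have *: "p = (if s then hi else 2 * int d - 1 - hi)" "q = (if t then lo else - 1 - lo)"
        by (auto simp: hi_def lo_def)
      show "z \<in> P ` (U \<times> V \<times> UNIV \<times> UNIV)"
      proof (cases "G hi")
        case True
        with G hl have "(p, q) = P (hi, lo, s, t)" "hi \<in> U" "lo \<in> V"
          by (auto simp: P_def * U_def V_def)
        then show ?thesis unfolding z p_def[symmetric] q_def[symmetric] by blast
      next
        case False
        with G hl have "(p, q) = P (lo, hi, s, t)" "hi \<in> V" "lo \<in> U"
          by (auto simp: P_def * U_def V_def)
        then show ?thesis unfolding z p_def[symmetric] q_def[symmetric] by blast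
      qed
    qed
  qed
  from bij_betw_same_card[OF this] card_P show ?thesis by (simp add: U_def V_def)
qed

text \<open>In each variable the indicator is even, has period \<open>4 * d\<close> and vanishes at
  0 and \<open>2 * d\<close>. So \<open>sum_reflection\<close> with block length
  \<open>2 * d\<close> applies to every row and then to the row sums.\<close>

lemma card_sites_dAlembert_eq:
  fixes G :: "int \<Rightarrow> bool" and d k l :: nat
  assumes refl: "\<And>p. G (- 1 - p) = G p" and per: "\<And>p. G (p + 2 * int d) = G p"
  shows "card {(a, b) \<in> sites (d * k) (d * l). dAlembert G a b} =
    4 * card {p \<in> {0..<int d}. G p} * card {p \<in> {0..<int d}. \<not> G p} * k * l"
proof -
  note minus = dAlembert_minus[of G, OF refl] and add = dAlembert_add[of G, OF per]
  note ends = dAlembert_half_period[of G, OF refl per]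
  define f where "f a b = (of_bool (dAlembert G a b) :: nat)" for a b
  have f: "f (- a) b = f a b" "f a (- b) = f a b" "f (a + 4 * int d) b = f a b"
    "f a (b + 4 * int d) = f a b" "f 0 b = 0" "f a 0 = 0" "f (2 * int d) b = 0" "f a (2 * int d) = 0"
    for a b
    using minus add ends dAlembert_zero[of G, OF refl] by (simp_all add: f_def)
  have row: "(\<Sum>b\<in>{0..<2 * int (d * l)}. f a b) = l * (\<Sum>b\<in>{0..<2 * int d}. f a b)" for a
    using sum_reflection[of "f a" "2 * d" l] f by (simp add: mult.assoc)
  have "(\<Sum>a\<in>{0..<2 * int (d * k)}. \<Sum>b\<in>{0..<2 * int d}. f a b) =
    k * (\<Sum>a\<in>{0..<2 * int d}. \<Sum>b\<in>{0..<2 * int d}. f a b)"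
    using sum_reflection[of "\<lambda>a. \<Sum>b\<in>{0..<2 * int d}. f a b" "2 * d" k] f
    by (simp add: mult.assoc)
  then have "card {(a, b) \<in> sites (d * k) (d * l). dAlembert G a b} =
    k * l * card {(a, b) \<in> sites d d. dAlembert G a b}"
    unfolding card_sites_dAlembert[of G, OF refl] f_def[symmetric] row
    by (simp add: sum_distrib_left[symmetric] mult.assoc mult.left_commute)
  then show ?thesis unfolding card_block_dAlembert[of G, OF refl per] by simp
qed

section \<open>The common period, and the two directions of the theorem\<close>

lemma gcd_period:
  fixes G :: "int \<Rightarrow> 'a"
  assumes "\<And>p. G (p + 2 * x) = G p" and "\<And>p. G (p + 2 * y) = G p"
  shows "G (p + 2 * gcd x y) = G p"
proof -
  have mult: "G (p + 2 * z * k) = G p" if "\<And>p. G (p + 2 * z) = G p" for p z k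
    using int_const_of_step[of "\<lambda>k. G (p + 2 * z * k)" k] that[of "p + 2 * z * i" for i]
    by (simp add: algebra_simps)
  obtain u v where "u * x + v * y = gcd x y" using bezout_int by blast
  then have "p + 2 * gcd x y = p + 2 * x * u + 2 * y * v" by (simp add: algebra_simps)
  also have "G \<dots> = G p"
    using mult[of x, OF assms(1)] mult[of y, OF assms(2)] by metis
  finally show ?thesis .
qed

text \<open>Neighbours of an interior point may lie on the frame. The formula vanishes there, so on
  the closed rectangle it agrees with membership in the set and the wave equation transfers.\<close>

lemma totally_even_dAlembert:
  assumes refl: "\<And>p. G (- 1 - p) = G p" and "\<And>p. G (p + 2 * int m) = G p"
    and "\<And>p. G (p + 2 * int n) = G p"
  shows "totally_even (grid m n) (edge_at ` {(a, b) \<in> sites m n. dAlembert G a b})"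
    (is "totally_even _ (edge_at ` ?S)")
proof -
  have "?S \<subseteq> sites m n" by auto
  moreover have "even (card (?S \<inter> nbrs a b))"
    if ab: "0 < a" "a < 2 * int m" "0 < b" "b < 2 * int n" "even (a + b)" for a b
  proof -
    note ends = dAlembert_half_period(1)[of G, OF refl assms(2)]
      dAlembert_half_period(2)[of G, OF refl assms(3)]
    have mem: "(x, y) \<in> ?S \<longleftrightarrow> dAlembert G x y"
      if "0 \<le> x" "x \<le> 2 * int m" "0 \<le> y" "y \<le> 2 * int n" for x y
    proof -
      have "dAlembert G x y \<Longrightarrow> x \<noteq> 0 \<and> y \<noteq> 0 \<and> x \<noteq> 2 * int m \<and> y \<noteq> 2 * int n"
        using ends dAlembert_zero[of G, OF refl] by metis
      moreover have "dAlembert G x y \<Longrightarrow> odd (x + y)" by (simp add: dAlembert_def)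
      ultimately show ?thesis using that by (auto simp: sites_def)
    qed
    have "(a - 1, b) \<in> ?S \<longleftrightarrow> dAlembert G (a - 1) b" "(a + 1, b) \<in> ?S \<longleftrightarrow> dAlembert G (a + 1) b"
      "(a, b - 1) \<in> ?S \<longleftrightarrow> dAlembert G a (b - 1)" "(a, b + 1) \<in> ?S \<longleftrightarrow> dAlembert G a (b + 1)"
      by (rule mem; use ab in linarith)+
    with dAlembert_wave[OF ab(5), of G] show ?thesis
      unfolding even_card_Int_nbrs_iff by blast
  qed
  ultimately show ?thesis by (simp add: totally_even_edge_at_iff)
qed

theorem corollary2:
  fixes m n d m' n' :: nat
  assumes "m > 0" and "n > 0"
    and "d = gcd m n" and "m = d * m'" and "n = d * n'"
  shows "(\<forall>E. totally_even (grid m n) E \<longrightarrow>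
            (\<exists>u v :: nat. u + v = d \<and> card E = 4 * u * v * m' * n')) \<and>
         (\<forall>u v :: nat. u + v = d \<longrightarrow>
            (\<exists>E. totally_even (grid m n) E \<and> card E = 4 * u * v * m' * n'))"
proof (intro conjI allI impI)
  have card_edge_at: "card (edge_at ` S) = card S" if "S \<subseteq> sites m n" for S
    by (intro card_image inj_on_subset[OF inj_on_edge_at]) (use that in \<open>auto simp: sites_def\<close>)
  {
    fix E assume te: "totally_even (grid m n) E"
    define S where "S = {z \<in> sites m n. edge_at z \<in> E}"
    have S: "S \<subseteq> sites m n" by (auto simp: S_def)
    have E: "E = edge_at ` S"
      using te unfolding totally_even_def edges_grid S_def by blast
    obtain G where G: "\<And>p. G (- 1 - p) = G p" "\<And>p. G (p + 2 * int m) = G p"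
      "\<And>p. G (p + 2 * int n) = G p" "S = {(a, b) \<in> sites m n. dAlembert G a b}"
      using ex_profile[OF S assms(1,2)] te E by blast
    have per: "G (p + 2 * int d) = G p" for p
      using gcd_period[of G "int m" "int n", OF G(2,3)] assms(3) by simp
    define u v where "u = card {p \<in> {0..<int d}. G p}" and "v = card {p \<in> {0..<int d}. \<not> G p}"
    have "{p \<in> {0..<int d}. G p} \<union> {p \<in> {0..<int d}. \<not> G p} = {0..<int d}" by auto
    moreover have "finite {p \<in> {0..<int d}. G p}" "finite {p \<in> {0..<int d}. \<not> G p}"
      by (rule finite_subset[of _ "{0..<int d}"]; auto)+
    ultimately have "u + v = card {0..<int d}"
      unfolding u_def v_def by (subst card_Un_disjoint[symmetric]) auto
    then have "u + v = d" by simp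
    moreover have "card E = 4 * u * v * m' * n'"
      unfolding E card_edge_at[OF S] unfolding G(4) u_def v_def assms(4,5)
      by (rule card_sites_dAlembert_eq) (use G(1) per in auto)
    ultimately show "\<exists>u v :: nat. u + v = d \<and> card E = 4 * u * v * m' * n'" by blast
  }
  fix u v :: nat
  assume uv: "u + v = d"
  have "d > 0" using assms(1,3) by simp
  \<comment> \<open>The first clause marks the first \<open>u\<close> of the \<open>d\<close> free
    indices; the second adds their mirror images, which makes \<open>G\<close> even. As
    \<open>u\<close> is at most \<open>d\<close>, these images stay out of \<open>{0..<d}\<close>
    and leave exactly \<open>v\<close> unmarked indices there.\<close>
  define G where "G p \<longleftrightarrow> p mod (2 * int d) < int u \<or> 2 * int d - int u \<le> p mod (2 * int d)" for p
  have refl: "G (- 1 - p) = G p" for p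
  proof -
    define r where "r = p mod (2 * int d)"
    have r: "0 \<le> r" "r < 2 * int d" using \<open>d > 0\<close> by (simp_all add: r_def)
    have "- 1 - p = 2 * int d - 1 - r + (2 * int d) * (- (p div (2 * int d)) - 1)"
      using div_mult_mod_eq[of p "2 * int d"] unfolding r_def by (simp add: algebra_simps)
    then have "(- 1 - p) mod (2 * int d) = (2 * int d - 1 - r) mod (2 * int d)"
      by (simp only: mod_mult_self2)
    also have "\<dots> = 2 * int d - 1 - r" using r by (intro mod_pos_pos_trivial) auto
    finally show ?thesis unfolding G_def r_def[symmetric] by auto
  qed
  have "G (p + 2 * int d * k) = G p" for p k by (simp add: G_def)
  note this[of _ 1] this[of _ "int m'"] this[of _ "int n'"]
  then have per: "G (p + 2 * int d) = G p" "G (p + 2 * int m) = G p" "G (p + 2 * int n) = G p" for p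
    unfolding assms(4,5) by (simp_all add: mult.assoc)
  have "{p \<in> {0..<int d}. G p} = {0..<int u}" "{p \<in> {0..<int d}. \<not> G p} = {int u..<int d}"
    using uv by (auto simp: G_def)
  then have cards: "card {p \<in> {0..<int d}. G p} = u" "card {p \<in> {0..<int d}. \<not> G p} = v"
    using uv by auto
  have "card (edge_at ` {(a, b) \<in> sites m n. dAlembert G a b}) = card {(a, b) \<in> sites m n. dAlembert G a b}"
    by (rule card_edge_at) auto
  also have "\<dots> = 4 * u * v * m' * n'"
    using card_sites_dAlembert_eq[of G d m' n', OF refl per(1)] unfolding cards assms(4,5) .
  finally show "\<exists>E. totally_even (grid m n) E \<and> card E = 4 * u * v * m' * n'"
    using totally_even_dAlembert[of G m n, OF refl per(2,3)] by blast
qed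

end
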